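(* For all $a\in(0,1)$, all odd positive integers $k\in\{2n+1 : n\in\mathbb{N}_0\}$ and all $x\in(1,\infty)$, $$\psi^{(k)}(a)-\psi^{(k)}(1)+k!\left(\frac{a}{x^{k+1}}-\frac{1}{a^{k+1}}-a\right)<\psi^{(k)}(x+a)-\psi^{(k)}(x)<\frac{a\,k!}{x^{k+1}}.$$
   Context: $\mathbb{N}_0=\{0,1,2,\dots\}$. $\Gamma$ is the classical Gamma function, $\psi(x)=\frac{d}{dx}\ln\Gamma(x)$ for $x>0$ is the digamma function, and $\psi^{(k)}$ is its $k$-th derivative (polygamma function). *)

theory Defs
  imports "HOL-Analysis.Analysis"
begin

text \<open>
  The library introduces \<^const>\<open>Digamma\<close> by a limit and \<^const>\<open>Polygamma\<close> by a series. On the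
  positive reals they are the derivatives of the logarithm of the Gamma function:
\<close>

lemma higher_deriv_ln_Gamma_eq_Polygamma:
  fixes x :: real
  assumes "x > 0"
  shows "(deriv ^^ k) (deriv (\<lambda>t. ln (Gamma t))) x = Polygamma k x"
proof -
  have "eventually (\<lambda>t. t \<in> {0<..}) (nhds x)"
    using assms by (intro eventually_nhds_in_open) auto
  then have "eventually (\<lambda>t. ln (Gamma t) = ln_Gamma t) (nhds x)"
    by eventually_elim (simp add: ln_Gamma_real_pos)
  then have "(deriv ^^ Suc k) (\<lambda>t. ln (Gamma t)) x = (deriv ^^ Suc k) ln_Gamma x"
    by (intro higher_deriv_cong_ev) auto
  then show ?thesis
    using higher_deriv_ln_Gamma_real[OF assms, of "Suc k"]
    by (simp add: funpow_Suc_right del: funpow.simps)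
qed

end

theory Submission
  imports Defs
begin

text \<open>
  For odd \<open>k\<close> the function \<open>Polygamma k\<close> is strictly decreasing and strictly convex on the positive
  reals, so \<open>Polygamma k (x + a) - Polygamma k x\<close> is negative and strictly increasing in \<open>x\<close>. The
  upper bound follows from the sign. For the lower bound, compare the value at \<open>x\<close> with the value
  at \<open>1\<close>, where the recurrence turns \<open>Polygamma k (1 + a)\<close> into
  \<open>Polygamma k a - fact k / a ^ (k + 1)\<close>; the remaining term \<open>a / x ^ (k + 1) - a\<close> is negative.
\<close>

lemma Polygamma_shift_diff_strict_mono:
  fixes a x y :: real
  assumes "odd k" "0 < a" "0 < x" "x < y"
  shows "Polygamma k (x + a) - Polygamma k x < Polygamma k (y + a) - Polygamma k y"
proof (rule DERIV_pos_imp_increasing[OF \<open>x < y\<close>])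
  fix t assume "x \<le> t" "t \<le> y"
  then have "t > 0" using assms by simp
  then have "((\<lambda>t. Polygamma k (t + a) - Polygamma k t) has_real_derivative
      Polygamma (Suc k) (t + a) - Polygamma (Suc k) t) (at t)"
    \<comment> \<open>Positivity keeps \<open>t\<close> and \<open>t + a\<close> away from the poles
      at the nonpositive integers.\<close>
    using assms by (auto intro!: derivative_eq_intros elim!: nonpos_Ints_cases)
  \<comment> \<open>Monotonicity flips with parity: \<open>Suc k\<close> is even.\<close>
  moreover have "Polygamma (Suc k) t < Polygamma (Suc k) (t + a)"
    using assms \<open>t > 0\<close> by (intro Polygamma_real_strict_mono) auto
  ultimately show "\<exists>d. ((\<lambda>t. Polygamma k (t + a) - Polygamma k t) has_real_derivative d) (at t) \<and> 0 < d"
    by (intro exI conjI) auto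
qed

theorem corollary2p10:
  fixes a x :: real and k :: nat
  assumes "a \<in> {0<..<1}"
    and "odd k"
    and "x \<in> {1<..}"
  shows "Polygamma k a - Polygamma k 1 + fact k * (a / x ^ (k + 1) - 1 / a ^ (k + 1) - a)
           < Polygamma k (x + a) - Polygamma k x
       \<and> Polygamma k (x + a) - Polygamma k x < a * fact k / x ^ (k + 1)"
proof
  have a: "a > 0" and x: "x > 1"
    using assms by auto
  have "a / x ^ (k + 1) < a"
    using a x by (simp add: divide_less_eq one_less_power del: power_Suc)
  \<comment> \<open>The claimed lower bound is exactly
    \<open>Polygamma k (1 + a) - Polygamma k 1\<close> plus this negative term.\<close>
  then have "fact k * (a / x ^ (k + 1) - a) < 0"
    by (simp add: mult_less_0_iff)
  \<comment> \<open>The minus sign is the factor \<open>(-1) ^ k\<close> of the recurrence for odd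
    \<open>k\<close>.\<close>
  moreover have "Polygamma k (1 + a) = Polygamma k a - fact k / a ^ (k + 1)"
    using Polygamma_plus1[of a k] a \<open>odd k\<close> by (simp add: add.commute)
  moreover have "Polygamma k (1 + a) - Polygamma k 1 < Polygamma k (x + a) - Polygamma k x"
    using a x \<open>odd k\<close> by (intro Polygamma_shift_diff_strict_mono) auto
  ultimately show "Polygamma k a - Polygamma k 1 + fact k * (a / x ^ (k + 1) - 1 / a ^ (k + 1) - a)
      < Polygamma k (x + a) - Polygamma k x"
    by (simp add: algebra_simps)
  have "Polygamma k (x + a) < Polygamma k x"
    using a x \<open>odd k\<close> by (intro Polygamma_real_strict_antimono) auto
  moreover have "0 < a * fact k / x ^ (k + 1)"
    using a x by simp
  ultimately show "Polygamma k (x + a) - Polygamma k x < a * fact k / x ^ (k + 1)"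
    by linarith
qed

end
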